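(* Let a finite group $G$ act faithfully on a set $X$ with $|X|=n$ elements. Then the function sending a positive integer $m$ to the number of distinguishing labelings of $X$ with labels from $\{1,2,\ldots,m\}$ is given by a polynomial $f_{G,X}(x)$ of degree $n$.
   Context: A distinguishing labeling of $X$ with labels from $\{1,\ldots,m\}$ is a function $\phi:X\to\{1,\ldots,m\}$ (not necessarily surjective) such that the only $g\in G$ with $\phi(gx)=\phi(x)$ for all $x\in X$ is the identity. The polynomial $f_{G,X}$ is called the distinguishing polynomial of the action of $G$ on $X$. *)

theory Defs
  imports
    "HOL-Algebra.Group_Action"
    "HOL-Library.FuncSet"
    "HOL-Computational_Algebra.Polynomial"
begin

definition distinguishing ::
    "('g, 'c) monoid_scheme \<Rightarrow> 'x set \<Rightarrow> ('g \<Rightarrow> 'x \<Rightarrow> 'x) \<Rightarrow> ('x \<Rightarrow> 'l) \<Rightarrow> bool"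
  where "distinguishing G X act \<phi> \<longleftrightarrow>
    (\<forall>g \<in> carrier G. (\<forall>x \<in> X. \<phi> (act g x) = \<phi> x) \<longrightarrow> g = \<one>\<^bsub>G\<^esub>)"

(* The extensional function space makes each map X -> {1..m} a single HOL function,
   so that the cardinality of this set is the number of labelings. *)
definition distinguishing_labelings ::
    "('g, 'c) monoid_scheme \<Rightarrow> 'x set \<Rightarrow> ('g \<Rightarrow> 'x \<Rightarrow> 'x) \<Rightarrow> nat \<Rightarrow> ('x \<Rightarrow> nat) set"
  where "distinguishing_labelings G X act m =
    {\<phi> \<in> X \<rightarrow>\<^sub>E {1..m}. distinguishing G X act \<phi>}"

end

theory Submission
  imports Defs
begin

text \<open>
  Whether a labeling is distinguishing depends only on which elements share a label. Hence the
  number of distinguishing labelings with image exactly \<open>I\<close> depends only on \<open>k = card I\<close>; call it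
  \<open>a k\<close>. Sorting the labelings by their image gives the polynomial
  \<open>\<Sum>k\<le>n. a k * (m choose k)\<close> in \<open>m\<close>. Its degree is \<open>n\<close> because \<open>a n \<noteq> 0\<close>: an injective
  labeling is distinguishing when the action is faithful.
\<close>

text \<open>The binomial coefficient \<open>x choose k\<close> as a polynomial in \<open>x\<close>;
  the monic linear factors make its degree and its leading coefficient \<open>1 / fact k\<close>
  readable.\<close>

definition binomial_poly :: "nat \<Rightarrow> 'a::field_char_0 poly"
  where "binomial_poly k = smult (1 / fact k) (\<Prod>i<k. [:- of_nat i, 1:])"

lemma poly_binomial_poly: "poly (binomial_poly k) (of_nat m) = of_nat (m choose k)"
  by (simp add: binomial_poly_def poly_prod binomial_gbinomial gbinomial_prod_rev lessThan_atLeast0)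

lemma degree_binomial_poly [simp]: "degree (binomial_poly k) = k"
  by (simp add: binomial_poly_def degree_prod_sum_eq)

text \<open>Only the summand \<open>k = n\<close> reaches degree \<open>n\<close>, so the
  coefficient there is \<open>c n / fact n\<close>.\<close>

lemma degree_sum_binomial_poly:
  assumes "c n \<noteq> 0"
  shows "degree (\<Sum>k\<le>n. smult (c k) (binomial_poly k)) = n"
proof (rule antisym)
  show "degree (\<Sum>k\<le>n. smult (c k) (binomial_poly k)) \<le> n"
    by (rule degree_sum_le) (auto simp: degree_smult_eq)
  have "coeff (\<Sum>k\<le>n. smult (c k) (binomial_poly k)) n
      = (\<Sum>k\<le>n. if k = n then c n * lead_coeff (binomial_poly n) else 0)"
    unfolding coeff_sum by (intro sum.cong) (auto simp: coeff_eq_0)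
  moreover have "lead_coeff (binomial_poly n :: 'a poly) \<noteq> 0"
    by (auto simp: binomial_poly_def)
  ultimately have "coeff (\<Sum>k\<le>n. smult (c k) (binomial_poly k)) n \<noteq> 0"
    using assms by simp
  then show "n \<le> degree (\<Sum>k\<le>n. smult (c k) (binomial_poly k))"
    by (rule le_degree)
qed

text \<open>The cutoff \<open>n\<close> is independent of \<open>A\<close>: for
  \<open>A = {1..m}\<close> the range of \<open>k\<close> stays fixed as \<open>m\<close> varies, so
  the right side is polynomial in \<open>m\<close>.\<close>

lemma sum_card_subsets:
  fixes c :: "nat \<Rightarrow> 'b::comm_semiring_1"
  assumes "finite A"
  shows "(\<Sum>I | I \<subseteq> A \<and> card I \<le> n. c (card I)) = (\<Sum>k\<le>n. c k * of_nat (card A choose k))"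
proof -
  let ?S = "{I. I \<subseteq> A \<and> card I \<le> n}"
  have "(\<Sum>I\<in>?S. c (card I)) = (\<Sum>k\<le>n. \<Sum>I | I \<in> ?S \<and> card I = k. c (card I))"
    using assms by (intro sum.group [symmetric]) auto
  also have "\<dots> = (\<Sum>k\<le>n. c k * of_nat (card A choose k))"
  proof (rule sum.cong)
    fix k assume "k \<in> {..n}"
    then have "{I. I \<in> ?S \<and> card I = k} = {I. I \<subseteq> A \<and> card I = k}"
      by auto
    then show "(\<Sum>I | I \<in> ?S \<and> card I = k. c (card I)) = c k * of_nat (card A choose k)"
      using n_subsets [OF assms, of k] by (simp add: mult.commute)
  qed simp
  finally show ?thesis .
qed

definition surj_distinguishing ::
    "('g, 'c) monoid_scheme \<Rightarrow> 'x set \<Rightarrow> ('g \<Rightarrow> 'x \<Rightarrow> 'x) \<Rightarrow> 'l set \<Rightarrow> ('x \<Rightarrow> 'l) set"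
  where "surj_distinguishing G X act I = {\<phi> \<in> X \<rightarrow>\<^sub>E I. \<phi> ` X = I \<and> distinguishing G X act \<phi>}"

lemma finite_surj_distinguishing:
  assumes "finite X" "finite I"
  shows "finite (surj_distinguishing G X act I)"
  unfolding surj_distinguishing_def using assms by (simp add: finite_PiE)

context group_action
begin

text \<open>An injective relabeling merges no two labels in use, so the same group elements preserve
  the labeling. In this locale \<open>\<phi>\<close> is the action and \<open>f\<close> the
  labeling.\<close>

lemma distinguishing_compose_inj:
  assumes "distinguishing G E \<phi> f" "inj_on h (f ` E)"
  shows "distinguishing G E \<phi> (compose E h f)"
  using assms unfolding distinguishing_def
  by (simp add: compose_def element_image inj_on_eq_iff)

text \<open>Relabeling along \<open>h\<close> is an injection between the two sets;
  \<open>compose E h\<close> rather than plain composition keeps the result extensional.\<close>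

lemma card_surj_distinguishing_le:
  assumes "finite E" "finite J" "bij_betw h I J"
  shows "card (surj_distinguishing G E \<phi> I) \<le> card (surj_distinguishing G E \<phi> J)"
proof (rule card_inj_on_le)
  show "inj_on (compose E h) (surj_distinguishing G E \<phi> I)"
  proof (rule inj_onI)
    fix f g
    assume f: "f \<in> surj_distinguishing G E \<phi> I" and g: "g \<in> surj_distinguishing G E \<phi> I"
      and eq: "compose E h f = compose E h g"
    show "f = g"
    proof (rule PiE_ext)
      show "f \<in> E \<rightarrow>\<^sub>E I" "g \<in> E \<rightarrow>\<^sub>E I"
        using f g by (auto simp: surj_distinguishing_def)
      then show "f x = g x" if "x \<in> E" for x
        using that fun_cong [OF eq, of x] assms(3)
        by (auto simp: compose_def bij_betw_def dest: inj_onD)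
    qed
  qed
  show "compose E h ` surj_distinguishing G E \<phi> I \<subseteq> surj_distinguishing G E \<phi> J"
  proof (rule image_subsetI)
    fix f assume "f \<in> surj_distinguishing G E \<phi> I"
    then have f: "f ` E = I" "distinguishing G E \<phi> f"
      by (auto simp: surj_distinguishing_def)
    have "compose E h f ` E = h ` f ` E"
      by (simp add: compose_def image_image)
    also have "\<dots> = J"
      using f assms(3) by (simp add: bij_betw_def)
    finally have im: "compose E h f ` E = J" .
    have "distinguishing G E \<phi> (compose E h f)"
      using f assms(3) by (intro distinguishing_compose_inj) (auto simp: bij_betw_def)
    moreover have "compose E h f \<in> E \<rightarrow>\<^sub>E J"
      using im by (auto simp: PiE_def)
    ultimately show "compose E h f \<in> surj_distinguishing G E \<phi> J"
      using im by (simp add: surj_distinguishing_def)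
  qed
  show "finite (surj_distinguishing G E \<phi> J)"
    using assms by (simp add: finite_surj_distinguishing)
qed

lemma card_surj_distinguishing_cong:
  assumes "finite E" "finite I" "finite J" "card I = card J"
  shows "card (surj_distinguishing G E \<phi> I) = card (surj_distinguishing G E \<phi> J)"
proof -
  obtain h where "bij_betw h I J"
    using assms finite_same_card_bij by blast
  then show ?thesis
    using assms by (intro antisym card_surj_distinguishing_le) (auto intro: bij_betw_inv_into)
qed

text \<open>Each labeling is filed under its own image, which has at most \<open>card E\<close>
  elements; recording this bound caps the later sum independently of \<open>m\<close>.\<close>

lemma distinguishing_labelings_eq_UN:
  assumes "finite E"
  shows "distinguishing_labelings G E \<phi> m =
    (\<Union>I \<in> {I. I \<subseteq> {1..m} \<and> card I \<le> card E}. surj_distinguishing G E \<phi> I)"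
proof (intro subset_antisym subsetI)
  fix f assume f: "f \<in> distinguishing_labelings G E \<phi> m"
  then have "f \<in> surj_distinguishing G E \<phi> (f ` E)" "f ` E \<subseteq> {1..m}"
    by (auto simp: distinguishing_labelings_def surj_distinguishing_def PiE_def)
  with card_image_le [OF assms, of f]
  show "f \<in> (\<Union>I \<in> {I. I \<subseteq> {1..m} \<and> card I \<le> card E}. surj_distinguishing G E \<phi> I)"
    by blast
next
  fix f assume "f \<in> (\<Union>I \<in> {I. I \<subseteq> {1..m} \<and> card I \<le> card E}. surj_distinguishing G E \<phi> I)"
  then show "f \<in> distinguishing_labelings G E \<phi> m"
    by (fastforce simp: distinguishing_labelings_def surj_distinguishing_def PiE_def)
qed

lemma card_distinguishing_labelings:
  assumes "finite E"
  shows "card (distinguishing_labelings G E \<phi> m) =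
    (\<Sum>k\<le>card E. card (surj_distinguishing G E \<phi> {1..k}) * (m choose k))"
proof -
  let ?S = "{I. I \<subseteq> {1..m} \<and> card I \<le> card E}"
  have fin: "finite I" if "I \<in> ?S" for I
    using that finite_subset by blast
  have "card (distinguishing_labelings G E \<phi> m) = (\<Sum>I\<in>?S. card (surj_distinguishing G E \<phi> I))"
    unfolding distinguishing_labelings_eq_UN [OF assms]
  \<comment> \<open>The union is disjoint because a labeling determines its image.\<close>
  proof (rule card_UN_disjoint)
    show "\<forall>I\<in>?S. finite (surj_distinguishing G E \<phi> I)"
      using assms fin by (simp add: finite_surj_distinguishing)
  qed (auto simp: surj_distinguishing_def)
  \<comment> \<open>\<open>{1..card I}\<close> serves as the standard label set of its size.\<close>
  also have "\<dots> = (\<Sum>I\<in>?S. card (surj_distinguishing G E \<phi> {1..card I}))"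
    using assms fin by (intro sum.cong card_surj_distinguishing_cong) auto
  also have "\<dots> = (\<Sum>k\<le>card E. card (surj_distinguishing G E \<phi> {1..k}) * (m choose k))"
    using sum_card_subsets [of "{1..m}" "\<lambda>k. card (surj_distinguishing G E \<phi> {1..k})"] by simp
  finally show ?thesis .
qed

end

context faithful_action
begin

text \<open>Injectivity turns preservation of labels into \<open>\<phi> g x = x\<close> on all of
  \<open>E\<close>, and faithfulness then forces \<open>g\<close> to be the identity.\<close>

lemma distinguishing_inj:
  assumes "inj_on f E"
  shows "distinguishing G E \<phi> f"
  unfolding distinguishing_def
proof (intro ballI impI)
  interpret group_hom G "BijGroup E" \<phi> by (rule group_hom)
  fix g assume g: "g \<in> carrier G" and "\<forall>x\<in>E. f (\<phi> g x) = f x"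
  then have "\<phi> g x = x" if "x \<in> E" for x
    using that assms element_image by (meson inj_onD)
  \<comment> \<open>The identity of \<open>BijGroup E\<close> is the identity map restricted to
    \<open>E\<close>, so equality with it also requires agreement outside \<open>E\<close>.\<close>
  moreover have "\<phi> g \<in> extensional E"
    using bij_prop0 [OF g] by (simp add: Bij_def)
  ultimately have "\<phi> g = (\<lambda>x\<in>E. x)"
    by (auto intro: extensionalityI)
  then have "\<phi> g = \<phi> \<one>"
    by (simp add: id_eq_one)
  then show "g = \<one>"
    by (rule inj_onD [OF faithful _ g G.one_closed])
qed

text \<open>This makes the top coefficient nonzero; the witness is any bijection from
  \<open>E\<close> onto \<open>{1..card E}\<close>, restricted to \<open>E\<close> to be
  extensional.\<close>

lemma card_surj_distinguishing_pos:
  assumes "finite E"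
  shows "card (surj_distinguishing G E \<phi> {1..card E}) > 0"
proof -
  obtain h where h: "bij_betw h E {1..card E}"
    using assms by (metis card_atLeastAtMost diff_Suc_1 finite_atLeastAtMost finite_same_card_bij)
  have bij: "bij_betw (restrict h E) E {1..card E}"
    using h by (simp cong: bij_betw_cong)
  then have "restrict h E \<in> surj_distinguishing G E \<phi> {1..card E}"
    using bij_betw_imp_surj_on [OF bij] bij_betw_imp_inj_on [OF bij, THEN distinguishing_inj]
      bij_betwE [OF h]
    unfolding surj_distinguishing_def by (auto simp: PiE_def)
  then show ?thesis
    using assms by (auto simp: card_gt_0_iff finite_surj_distinguishing)
qed

end

theorem theorem7p2:
  fixes G :: "('g, 'c) monoid_scheme"
    and X :: "'x set"
    and act :: "'g \<Rightarrow> 'x \<Rightarrow> 'x"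
    and n :: nat
  assumes "faithful_action G X act"
    and "finite (carrier G)"
    and "finite X"
    and "card X = n"
  shows "\<exists>f :: rat poly. degree f = n \<and>
    (\<forall>m \<ge> 1. of_nat (card (distinguishing_labelings G X act m)) = poly f (of_nat m))"
proof -
  interpret faithful_action G X act by fact
  define a where "a k = card (surj_distinguishing G X act {1..k})" for k :: nat
  define f :: "rat poly" where "f = (\<Sum>k\<le>n. smult (of_nat (a k)) (binomial_poly k))"
  have "a n \<noteq> 0"
    using card_surj_distinguishing_pos assms unfolding a_def by auto
  then have "degree f = n"
    unfolding f_def by (intro degree_sum_binomial_poly) simp
  moreover have "of_nat (card (distinguishing_labelings G X act m)) = poly f (of_nat m)" for m
    using card_distinguishing_labelings [of m] assms
    by (simp add: f_def a_def poly_sum poly_binomial_poly)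
  ultimately show ?thesis
    by blast
qed

end
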